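(* Let $R$ be a unital ring. 1. If $I$ is a right ideal of $R$ which is faithful as a right $R$-module then ${}'\mathcal{C}_R={}'\mathcal{C}_I$. 2. If $I$ is a left ideal of $R$ which is faithful as a left $R$-module then $\mathcal{C}'_R=\mathcal{C}'_I$. 3. If $I$ is an ideal of $R$ which is faithful as a left and as a right $R$-module then $\mathcal{C}_R=\mathcal{C}_I$.
   Context: ${}'\mathcal{C}_R=\{c\in R\mid rc=0\Rightarrow r=0\}$, $\mathcal{C}'_R=\{c\in R\mid cr=0\Rightarrow r=0\}$, $\mathcal{C}_R={}'\mathcal{C}_R\cap\mathcal{C}'_R$. For a right $R$-module $M$, ${}'\mathcal{C}_M:=\{r\in R\mid\text{the map }M\to M,\ m\mapsto mr,\text{ is injective}\}$. For a left $R$-module $M$, $\mathcal{C}'_M:=\{r\in R\mid\text{the map }M\to M,\ m\mapsto rm,\text{ is injective}\}$. For an $R$-bimodule $M$, $\mathcal{C}_M:={}'\mathcal{C}_M\cap\mathcal{C}'_M$. These are applied to $M=I$ with the module structure induced by multiplication in $R$. *)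

theory Defs
  imports "HOL-Algebra.Algebra"
begin

section \<open>Modules over a not necessarily commutative ring\<close>

text \<open>
  The locale \<open>module\<close> of HOL-Algebra requires a commutative ring of scalars, so left and right modules
  are introduced here. A module is an abelian group \<open>M\<close> together with an explicit action of the ring;
  only \<open>carrier\<close>, \<open>add\<close> and \<open>zero\<close> of the record \<open>M\<close> are relevant. The zero ring is not excluded.
\<close>

locale right_module = R?: ring R + M?: abelian_group M
  for R :: "('a, 'm) ring_scheme" (structure) and M :: "('b, 'n) ring_scheme" (structure) and act :: "'b \<Rightarrow> 'a \<Rightarrow> 'b" +
  assumes ract_closed:
      "\<lbrakk>m \<in> carrier M; r \<in> carrier R\<rbrakk> \<Longrightarrow> act m r \<in> carrier M"
    and ract_add_left:
      "\<lbrakk>m \<in> carrier M; n \<in> carrier M; r \<in> carrier R\<rbrakk> \<Longrightarrow>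
       act (m \<oplus>\<^bsub>M\<^esub> n) r = act m r \<oplus>\<^bsub>M\<^esub> act n r"
    and ract_add_right:
      "\<lbrakk>m \<in> carrier M; r \<in> carrier R; s \<in> carrier R\<rbrakk> \<Longrightarrow>
       act m (r \<oplus>\<^bsub>R\<^esub> s) = act m r \<oplus>\<^bsub>M\<^esub> act m s"
    and ract_mult:
      "\<lbrakk>m \<in> carrier M; r \<in> carrier R; s \<in> carrier R\<rbrakk> \<Longrightarrow>
       act m (r \<otimes>\<^bsub>R\<^esub> s) = act (act m r) s"
    and ract_one:
      "m \<in> carrier M \<Longrightarrow> act m \<one>\<^bsub>R\<^esub> = m"

locale left_module = R?: ring R + M?: abelian_group M
  for R :: "('a, 'm) ring_scheme" (structure) and M :: "('b, 'n) ring_scheme" (structure) and act :: "'a \<Rightarrow> 'b \<Rightarrow> 'b" +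
  assumes lact_closed:
      "\<lbrakk>r \<in> carrier R; m \<in> carrier M\<rbrakk> \<Longrightarrow> act r m \<in> carrier M"
    and lact_add_right:
      "\<lbrakk>r \<in> carrier R; m \<in> carrier M; n \<in> carrier M\<rbrakk> \<Longrightarrow>
       act r (m \<oplus>\<^bsub>M\<^esub> n) = act r m \<oplus>\<^bsub>M\<^esub> act r n"
    and lact_add_left:
      "\<lbrakk>r \<in> carrier R; s \<in> carrier R; m \<in> carrier M\<rbrakk> \<Longrightarrow>
       act (r \<oplus>\<^bsub>R\<^esub> s) m = act r m \<oplus>\<^bsub>M\<^esub> act s m"
    and lact_mult:
      "\<lbrakk>r \<in> carrier R; s \<in> carrier R; m \<in> carrier M\<rbrakk> \<Longrightarrow>
       act (r \<otimes>\<^bsub>R\<^esub> s) m = act r (act s m)"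
    and lact_one:
      "m \<in> carrier M \<Longrightarrow> act \<one>\<^bsub>R\<^esub> m = m"

locale faithful_right_module = right_module +
  assumes faithful_right:
    "\<lbrakk>r \<in> carrier R; \<And>m. m \<in> carrier M \<Longrightarrow> act m r = \<zero>\<^bsub>M\<^esub>\<rbrakk> \<Longrightarrow> r = \<zero>\<^bsub>R\<^esub>"

locale faithful_left_module = left_module +
  assumes faithful_left:
    "\<lbrakk>r \<in> carrier R; \<And>m. m \<in> carrier M \<Longrightarrow> act r m = \<zero>\<^bsub>M\<^esub>\<rbrakk> \<Longrightarrow> r = \<zero>\<^bsub>R\<^esub>"


section \<open>One-sided ideals\<close>

locale right_ideal = additive_subgroup I R + ring R for I and R (structure) +
  assumes right_closed: "\<lbrakk>a \<in> I; x \<in> carrier R\<rbrakk> \<Longrightarrow> a \<otimes> x \<in> I"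

locale left_ideal = additive_subgroup I R + ring R for I and R (structure) +
  assumes left_closed: "\<lbrakk>a \<in> I; x \<in> carrier R\<rbrakk> \<Longrightarrow> x \<otimes> a \<in> I"

text \<open>
  The restriction of the record \<open>R\<close> to the carrier \<open>I\<close>, with the ring multiplication as action, is the
  module structure of an ideal induced by multiplication in \<open>R\<close>.
\<close>

abbreviation ideal_group :: "('a, 'm) ring_scheme \<Rightarrow> 'a set \<Rightarrow> ('a, 'm) ring_scheme"
  where "ideal_group R I \<equiv> R\<lparr>carrier := I\<rparr>"

lemma abelian_group_ideal_group:
  assumes "ring R" "additive_subgroup I R"
  shows "abelian_group (ideal_group R I)"
proof -
  interpret R: ring R by fact
  have sub: "subgroup I (add_monoid R)"
    using assms(2) by (rule additive_subgroup.a_subgroup)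
  have "group ((add_monoid R)\<lparr>carrier := I\<rparr>)"
    using R.add.is_group sub by (rule group.subgroup_imp_group)
  then have "comm_group ((add_monoid R)\<lparr>carrier := I\<rparr>)"
    by (rule group.group_comm_groupI)
      (use subgroup.subset[OF sub] in \<open>auto intro: R.a_comm\<close>)
  then have "comm_group (add_monoid (ideal_group R I))"
    by simp
  then show ?thesis
    by (simp add: abelian_group_def abelian_group_axioms_def abelian_monoid_def comm_group_def)
qed

lemma (in right_ideal) right_module_ideal: "right_module R (ideal_group R I) (\<otimes>)"
proof -
  interpret M: abelian_group "ideal_group R I"
    by (rule abelian_group_ideal_group) unfold_locales
  show ?thesis
    by unfold_locales (auto simp: right_closed l_distr r_distr m_assoc dest: subsetD[OF a_subset])
qed

lemma (in left_ideal) left_module_ideal: "left_module R (ideal_group R I) (\<otimes>)"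
proof -
  interpret M: abelian_group "ideal_group R I"
    by (rule abelian_group_ideal_group) unfold_locales
  show ?thesis
    by unfold_locales (auto simp: left_closed l_distr r_distr m_assoc dest: subsetD[OF a_subset])
qed


section \<open>Sets of regular elements\<close>

text \<open>
  A prime written before or after the letter \<open>C\<close> is spelled out as \<open>primeC\<close> or \<open>Cprime\<close>.
\<close>

definition primeC_ring :: "('a, 'm) ring_scheme \<Rightarrow> 'a set"
  where "primeC_ring R =
    {c \<in> carrier R. \<forall>r \<in> carrier R. r \<otimes>\<^bsub>R\<^esub> c = \<zero>\<^bsub>R\<^esub> \<longrightarrow> r = \<zero>\<^bsub>R\<^esub>}"

definition Cprime_ring :: "('a, 'm) ring_scheme \<Rightarrow> 'a set"
  where "Cprime_ring R =
    {c \<in> carrier R. \<forall>r \<in> carrier R. c \<otimes>\<^bsub>R\<^esub> r = \<zero>\<^bsub>R\<^esub> \<longrightarrow> r = \<zero>\<^bsub>R\<^esub>}"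

definition C_ring :: "('a, 'm) ring_scheme \<Rightarrow> 'a set"
  where "C_ring R = primeC_ring R \<inter> Cprime_ring R"

definition primeC_module ::
    "('a, 'm) ring_scheme \<Rightarrow> ('b, 'n) ring_scheme \<Rightarrow> ('b \<Rightarrow> 'a \<Rightarrow> 'b) \<Rightarrow> 'a set"
  where "primeC_module R M ract = {r \<in> carrier R. inj_on (\<lambda>m. ract m r) (carrier M)}"

definition Cprime_module ::
    "('a, 'm) ring_scheme \<Rightarrow> ('b, 'n) ring_scheme \<Rightarrow> ('a \<Rightarrow> 'b \<Rightarrow> 'b) \<Rightarrow> 'a set"
  where "Cprime_module R M lact = {r \<in> carrier R. inj_on (\<lambda>m. lact r m) (carrier M)}"

definition C_bimodule ::
    "('a, 'm) ring_scheme \<Rightarrow> ('b, 'n) ring_scheme \<Rightarrow>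
     ('a \<Rightarrow> 'b \<Rightarrow> 'b) \<Rightarrow> ('b \<Rightarrow> 'a \<Rightarrow> 'b) \<Rightarrow> 'a set"
  where "C_bimodule R M lact ract = primeC_module R M ract \<inter> Cprime_module R M lact"

end

theory Submission
  imports Defs
begin

text \<open>
  Let \<open>c\<close> act injectively on the right ideal \<open>I\<close> and let \<open>r c = 0\<close>. For every \<open>m\<close> in \<open>I\<close> the product
  \<open>m r\<close> lies again in \<open>I\<close> and is killed by \<open>c\<close>, so \<open>m r = 0\<close>; hence \<open>I r = 0\<close>, and faithfulness gives
  \<open>r = 0\<close>.
\<close>

text \<open>Right multiplication by \<open>c\<close> is additive on \<open>I\<close>, so it is
  injective exactly when its kernel is trivial. This brings the module condition into the same shape
  as the one defining \<open>primeC_ring\<close>, with \<open>I\<close> in place of the whole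
  ring.\<close>

lemma (in right_ideal) primeC_module_iff:
  "c \<in> primeC_module R (ideal_group R I) (\<otimes>) \<longleftrightarrow>
     c \<in> carrier R \<and> (\<forall>m \<in> I. m \<otimes> c = \<zero> \<longrightarrow> m = \<zero>)"
proof -
  have "inj_on (\<lambda>m. m \<otimes> c) I \<longleftrightarrow> (\<forall>m \<in> I. m \<otimes> c = \<zero> \<longrightarrow> m = \<zero>)"
    if c: "c \<in> carrier R"
  proof
    assume inj: "inj_on (\<lambda>m. m \<otimes> c) I"
    show "\<forall>m \<in> I. m \<otimes> c = \<zero> \<longrightarrow> m = \<zero>"
      \<comment> \<open>The element \<open>m\<close> is compared with zero, which also lies in
        \<open>I\<close> and is also sent to zero.\<close>
      using inj_onD[OF inj, of _ \<zero>] zero_closed c by simp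
  next
    assume reg: "\<forall>m \<in> I. m \<otimes> c = \<zero> \<longrightarrow> m = \<zero>"
    show "inj_on (\<lambda>m. m \<otimes> c) I"
    proof (rule inj_onI)
      fix m n assume mn: "m \<in> I" "n \<in> I" "m \<otimes> c = n \<otimes> c"
      then have R: "m \<in> carrier R" "n \<in> carrier R" using a_subset by auto
      have "(m \<ominus> n) \<otimes> c = \<zero>"
        using R c mn by (simp add: a_minus_def l_distr l_minus r_neg)
      \<comment> \<open>The difference is formed in \<open>R\<close>; it stays in \<open>I\<close>
        because \<open>I\<close> is an additive subgroup.\<close>
      moreover have "m \<ominus> n \<in> I"
        using mn by (simp add: a_minus_def)
      ultimately have "m \<ominus> n = \<zero>" using reg by blast
      then show "m = n" using R by simp
    qed
  qed
  then show ?thesis by (auto simp: primeC_module_def)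
qed

text \<open>The same kernel argument, applied to left multiplication by \<open>c\<close>.\<close>

lemma (in left_ideal) Cprime_module_iff:
  "c \<in> Cprime_module R (ideal_group R I) (\<otimes>) \<longleftrightarrow>
     c \<in> carrier R \<and> (\<forall>m \<in> I. c \<otimes> m = \<zero> \<longrightarrow> m = \<zero>)"
proof -
  have "inj_on (\<lambda>m. c \<otimes> m) I \<longleftrightarrow> (\<forall>m \<in> I. c \<otimes> m = \<zero> \<longrightarrow> m = \<zero>)"
    if c: "c \<in> carrier R"
  proof
    assume inj: "inj_on (\<lambda>m. c \<otimes> m) I"
    show "\<forall>m \<in> I. c \<otimes> m = \<zero> \<longrightarrow> m = \<zero>"
      using inj_onD[OF inj, of _ \<zero>] zero_closed c by simp
  next
    assume reg: "\<forall>m \<in> I. c \<otimes> m = \<zero> \<longrightarrow> m = \<zero>"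
    show "inj_on (\<lambda>m. c \<otimes> m) I"
    proof (rule inj_onI)
      fix m n assume mn: "m \<in> I" "n \<in> I" "c \<otimes> m = c \<otimes> n"
      then have R: "m \<in> carrier R" "n \<in> carrier R" using a_subset by auto
      have "c \<otimes> (m \<ominus> n) = \<zero>"
        using R c mn by (simp add: a_minus_def r_distr r_minus r_neg)
      moreover have "m \<ominus> n \<in> I"
        using mn by (simp add: a_minus_def)
      ultimately have "m \<ominus> n = \<zero>" using reg by blast
      then show "m = n" using R by simp
    qed
  qed
  then show ?thesis by (auto simp: Cprime_module_def)
qed

lemma (in right_ideal) primeC_ring_eq_primeC_module:
  assumes "faithful_right_module R (ideal_group R I) (\<otimes>)"
  shows "primeC_ring R = primeC_module R (ideal_group R I) (\<otimes>)"
proof (intro equalityI subsetI)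
  fix c assume "c \<in> primeC_ring R"
  \<comment> \<open>Cancellation against all of \<open>R\<close> restricts to the elements of
    \<open>I\<close>.\<close>
  then show "c \<in> primeC_module R (ideal_group R I) (\<otimes>)"
    unfolding primeC_module_iff using a_subset by (auto simp: primeC_ring_def)
next
  fix c assume "c \<in> primeC_module R (ideal_group R I) (\<otimes>)"
  then have c: "c \<in> carrier R" and reg: "\<And>m. m \<in> I \<Longrightarrow> m \<otimes> c = \<zero> \<Longrightarrow> m = \<zero>"
    unfolding primeC_module_iff by auto
  have "r = \<zero>" if r: "r \<in> carrier R" "r \<otimes> c = \<zero>" for r
  proof (rule faithful_right_module.faithful_right[OF assms r(1)])
    fix m assume "m \<in> carrier (ideal_group R I)"
    then have m: "m \<in> I" "m \<in> carrier R" using a_subset by auto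
    have "m \<otimes> r \<otimes> c = \<zero>" using m c r by (simp add: m_assoc)
    \<comment> \<open>The record update changes only the carrier, so this zero is the zero of
      \<open>R\<close>.\<close>
    then show "m \<otimes> r = \<zero>\<^bsub>ideal_group R I\<^esub>"
      using reg[OF right_closed] m r by simp
  qed
  then show "c \<in> primeC_ring R" using c by (simp add: primeC_ring_def)
qed

text \<open>Mirror image of the right-hand case: if \<open>c\<close> kills \<open>r\<close> from the
  left, then it kills every product of \<open>r\<close> with an element of \<open>I\<close>, so
  \<open>r\<close> annihilates \<open>I\<close> and left faithfulness applies.\<close>

lemma (in left_ideal) Cprime_ring_eq_Cprime_module:
  assumes "faithful_left_module R (ideal_group R I) (\<otimes>)"
  shows "Cprime_ring R = Cprime_module R (ideal_group R I) (\<otimes>)"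
proof (intro equalityI subsetI)
  fix c assume "c \<in> Cprime_ring R"
  then show "c \<in> Cprime_module R (ideal_group R I) (\<otimes>)"
    unfolding Cprime_module_iff using a_subset by (auto simp: Cprime_ring_def)
next
  fix c assume "c \<in> Cprime_module R (ideal_group R I) (\<otimes>)"
  then have c: "c \<in> carrier R" and reg: "\<And>m. m \<in> I \<Longrightarrow> c \<otimes> m = \<zero> \<Longrightarrow> m = \<zero>"
    unfolding Cprime_module_iff by auto
  have "r = \<zero>" if r: "r \<in> carrier R" "c \<otimes> r = \<zero>" for r
  proof (rule faithful_left_module.faithful_left[OF assms r(1)])
    fix m assume "m \<in> carrier (ideal_group R I)"
    then have m: "m \<in> I" "m \<in> carrier R" using a_subset by auto
    \<comment> \<open>Regrouping brings \<open>c\<close> next to \<open>r\<close>, where the product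
      vanishes.\<close>
    have "c \<otimes> (r \<otimes> m) = \<zero>" using m c r by (simp flip: m_assoc)
    then show "r \<otimes> m = \<zero>\<^bsub>ideal_group R I\<^esub>"
      using reg[OF left_closed] m r by simp
  qed
  then show "c \<in> Cprime_ring R" using c by (simp add: Cprime_ring_def)
qed

lemma (in ideal) right_ideal: "right_ideal I R"
  by unfold_locales (rule I_r_closed)

lemma (in ideal) left_ideal: "left_ideal I R"
  by unfold_locales (rule I_l_closed)

theorem lemma2p17:
  fixes R :: "('a, 'm) ring_scheme" (structure)
  assumes "ring R"
  shows "(\<forall>I. right_ideal I R \<and> faithful_right_module R (ideal_group R I) (\<otimes>)
            \<longrightarrow> primeC_ring R = primeC_module R (ideal_group R I) (\<otimes>))
       \<and> (\<forall>I. left_ideal I R \<and> faithful_left_module R (ideal_group R I) (\<otimes>)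
            \<longrightarrow> Cprime_ring R = Cprime_module R (ideal_group R I) (\<otimes>))
       \<and> (\<forall>I. ideal I R \<and> faithful_left_module R (ideal_group R I) (\<otimes>)
              \<and> faithful_right_module R (ideal_group R I) (\<otimes>)
            \<longrightarrow> C_ring R = C_bimodule R (ideal_group R I) (\<otimes>) (\<otimes>))"
proof (intro conjI allI impI; elim conjE)
  fix I assume "right_ideal I R" "faithful_right_module R (ideal_group R I) (\<otimes>)"
  then show "primeC_ring R = primeC_module R (ideal_group R I) (\<otimes>)"
    by (rule right_ideal.primeC_ring_eq_primeC_module)
next
  fix I assume "left_ideal I R" "faithful_left_module R (ideal_group R I) (\<otimes>)"
  then show "Cprime_ring R = Cprime_module R (ideal_group R I) (\<otimes>)"
    by (rule left_ideal.Cprime_ring_eq_Cprime_module)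
next
  fix I assume I: "ideal I R" "faithful_left_module R (ideal_group R I) (\<otimes>)"
    "faithful_right_module R (ideal_group R I) (\<otimes>)"
  show "C_ring R = C_bimodule R (ideal_group R I) (\<otimes>) (\<otimes>)"
    \<comment> \<open>Both sides are intersections of a right and a left part; these agree
      separately by the one-sided results, since a two-sided ideal is a right and a left
      ideal.\<close>
    unfolding C_ring_def C_bimodule_def
    using right_ideal.primeC_ring_eq_primeC_module[OF ideal.right_ideal[OF I(1)] I(3)]
      left_ideal.Cprime_ring_eq_Cprime_module[OF ideal.left_ideal[OF I(1)] I(2)]
    by simp
qed

end
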